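(* Let $G$ be a compact connected Lie group of dimension $g$, let $M$ be a complex projective $G$-variety of dimension $n$, and let $L\in\mathrm{Pic}^G(M)$ be such that $H^0(M,L^{\otimes m})^G\ne\{0\}$ for some $m\geq1$. Suppose that $p\in\mathbb N$ is relatively prime to $e_G(L)$. Then, for every highest weight $\mu$ of $G$, $$\mathrm{vol}_\mu(L^{\otimes p})=p^{\,n-g}\,\mathrm{vol}_\mu(L).$$
   Context: A complex projective $G$-variety is a complex projective variety with a holomorphic action of $G$. $\mathrm{Pic}^G(M)$ is the group of isomorphism classes of $G$-linearized holomorphic line bundles on $M$. Fix a maximal torus and Weyl chamber; $V_\mu$ is the irreducible $G$-representation of highest weight $\mu$, $H^0(M,L^{\otimes k})_\mu$ is the $V_\mu$-isotypic component of $H^0(M,L^{\otimes k})$, $H^0(M,L^{\otimes k})^G$ is the space of $G$-invariant sections, and $$\mathrm{vol}_\mu(L)=\limsup_{k\to+\infty}\frac{(n-g)!}{k^{n-g}}\dim H^0(M,L^{\otimes k})_\mu\in[0,+\infty]$$ (it is understood that $n\ge g$). The $G$-exponent $e_G(L)$ is the greatest common divisor of the elements of the semigroup $\{m\ge0: H^0(M,L^{\otimes m})^G\ne\{0\}\}$, which is assumed different from $\{0\}$. *)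

theory Defs
  imports
    "HOL-Analysis.Analysis"
    "HOL-Algebra.Group_Action"
    "HOL-Library.Function_Algebras"
    "HOL-Library.Extended_Nat"
begin

section \<open>Lie groups\<close>

text \<open>
  Manifolds of dimension \<open>d\<close> are modelled on \<^term>\<open>Euclidean_space d\<close>, the functions
  \<open>nat \<Rightarrow> real\<close> vanishing from \<open>d\<close> on, so that the dimension is an
  arbitrary natural number (including 0). \<open>Ck n k D f\<close>: all iterated partial derivatives
  of \<open>f\<close> of order at most \<open>k\<close> exist and are continuous on the open set \<open>D\<close>.
\<close>

primrec Ck :: "nat \<Rightarrow> nat \<Rightarrow> (nat \<Rightarrow> real) set \<Rightarrow> ((nat \<Rightarrow> real) \<Rightarrow> real) \<Rightarrow> bool" where
  "Ck n 0 D f \<longleftrightarrow> continuous_map (subtopology (Euclidean_space n) D) euclideanreal f"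
| "Ck n (Suc k) D f \<longleftrightarrow>
     continuous_map (subtopology (Euclidean_space n) D) euclideanreal f \<and>
     (\<forall>i<n. (\<forall>x\<in>D. (\<lambda>t. f (x(i := t))) differentiable (at (x i))) \<and>
            Ck n k D (\<lambda>x. deriv (\<lambda>t. f (x(i := t))) (x i)))"

definition smooth_map_on ::
  "nat \<Rightarrow> nat \<Rightarrow> (nat \<Rightarrow> real) set \<Rightarrow> ((nat \<Rightarrow> real) \<Rightarrow> (nat \<Rightarrow> real)) \<Rightarrow> bool" where
  "smooth_map_on n m D f \<longleftrightarrow> (\<forall>j<m. \<forall>k. Ck n k D (\<lambda>x. f x j))"

definition smooth_manifold ::
  "nat \<Rightarrow> 'a topology \<Rightarrow> ('a set \<times> ('a \<Rightarrow> nat \<Rightarrow> real)) set \<Rightarrow> bool" where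
  "smooth_manifold d X A \<longleftrightarrow>
     Hausdorff_space X \<and> second_countable X \<and>
     (\<Union>(U, \<phi>)\<in>A. U) = topspace X \<and>
     (\<forall>(U, \<phi>)\<in>A. openin X U \<and> openin (Euclidean_space d) (\<phi> ` U) \<and>
        homeomorphic_map (subtopology X U) (subtopology (Euclidean_space d) (\<phi> ` U)) \<phi>) \<and>
     (\<forall>(U, \<phi>)\<in>A. \<forall>(V, \<psi>)\<in>A.
        smooth_map_on d d (\<phi> ` (U \<inter> V)) (\<lambda>x. \<psi> (inv_into U \<phi> x)))"

record 'g lie_group = "'g monoid" +
  gtop :: "'g topology"
  atlas :: "('g set \<times> ('g \<Rightarrow> nat \<Rightarrow> real)) set"

definition fst_part :: "nat \<Rightarrow> (nat \<Rightarrow> real) \<Rightarrow> nat \<Rightarrow> real" where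
  "fst_part d z = (\<lambda>i. if i < d then z i else 0)"

definition snd_part :: "nat \<Rightarrow> (nat \<Rightarrow> real) \<Rightarrow> nat \<Rightarrow> real" where
  "snd_part d z = (\<lambda>i. if i < d then z (d + i) else 0)"

text \<open>
  Smoothness of the multiplication is expressed in product charts, with the two
  coordinate vectors concatenated to a point of \<^term>\<open>Euclidean_space (2 * d)\<close>.
\<close>

definition is_lie_group :: "nat \<Rightarrow> 'g lie_group \<Rightarrow> bool" where
  "is_lie_group d G \<longleftrightarrow>
     group G \<and> topspace (gtop G) = carrier G \<and>
     smooth_manifold d (gtop G) (atlas G) \<and>
     continuous_map (prod_topology (gtop G) (gtop G)) (gtop G) (\<lambda>(x, y). x \<otimes>\<^bsub>G\<^esub> y) \<and>
     continuous_map (gtop G) (gtop G) (\<lambda>x. inv\<^bsub>G\<^esub> x) \<and>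
     (\<forall>(U, \<phi>)\<in>atlas G. \<forall>(V, \<psi>)\<in>atlas G. \<forall>(W, \<theta>)\<in>atlas G.
        smooth_map_on (2 * d) d
          {z \<in> topspace (Euclidean_space (2 * d)).
             fst_part d z \<in> \<phi> ` U \<and> snd_part d z \<in> \<psi> ` V \<and>
             inv_into U \<phi> (fst_part d z) \<otimes>\<^bsub>G\<^esub> inv_into V \<psi> (snd_part d z) \<in> W}
          (\<lambda>z. \<theta> (inv_into U \<phi> (fst_part d z) \<otimes>\<^bsub>G\<^esub> inv_into V \<psi> (snd_part d z)))) \<and>
     (\<forall>(U, \<phi>)\<in>atlas G. \<forall>(V, \<psi>)\<in>atlas G.
        smooth_map_on d d (\<phi> ` {x \<in> U. inv\<^bsub>G\<^esub> x \<in> V})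
          (\<lambda>z. \<psi> (inv\<^bsub>G\<^esub> (inv_into U \<phi> z))))"

section \<open>Maximal tori, roots and Weyl chambers\<close>

definition std_torus :: "nat \<Rightarrow> (nat \<Rightarrow> complex) set" where
  "std_torus r = {z. (\<forall>i<r. norm (z i) = 1) \<and> (\<forall>i\<ge>r. z i = 1)}"

definition torus_in :: "'g lie_group \<Rightarrow> 'g set \<Rightarrow> bool" where
  "torus_in G T \<longleftrightarrow> subgroup T G \<and>
     (\<exists>r \<phi>. homeomorphic_map (top_of_set (std_torus r)) (subtopology (gtop G) T) \<phi> \<and>
        (\<forall>z\<in>std_torus r. \<forall>w\<in>std_torus r. \<phi> (\<lambda>i. z i * w i) = \<phi> z \<otimes>\<^bsub>G\<^esub> \<phi> w))"

definition maximal_torus :: "'g lie_group \<Rightarrow> 'g set \<Rightarrow> bool" where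
  "maximal_torus G T \<longleftrightarrow> torus_in G T \<and> (\<forall>T'. torus_in G T' \<and> T \<subseteq> T' \<longrightarrow> T' = T)"

text \<open>Only the values on \<open>T\<close> of a character of \<open>T\<close> are relevant below.\<close>

definition character :: "'g lie_group \<Rightarrow> 'g set \<Rightarrow> ('g \<Rightarrow> complex) \<Rightarrow> bool" where
  "character G T \<alpha> \<longleftrightarrow>
     continuous_map (subtopology (gtop G) T) euclidean \<alpha> \<and>
     (\<forall>t\<in>T. norm (\<alpha> t) = 1) \<and>
     (\<forall>s\<in>T. \<forall>t\<in>T. \<alpha> (s \<otimes>\<^bsub>G\<^esub> t) = \<alpha> s * \<alpha> t)"

text \<open>
  A chart \<open>(U, \<phi>)\<close> around the unit identifies the Lie algebra of \<open>G\<close>, the tangent space at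
  the unit, with \<open>\<real>\<^sup>d\<close>; these are the entries of the matrix of \<open>Ad h\<close>, the derivative at the
  unit of the conjugation by \<open>h\<close>.
\<close>

definition Ad_entry ::
  "'g lie_group \<Rightarrow> 'g set \<Rightarrow> ('g \<Rightarrow> nat \<Rightarrow> real) \<Rightarrow> 'g \<Rightarrow> nat \<Rightarrow> nat \<Rightarrow> real" where
  "Ad_entry G U \<phi> h i j =
     deriv (\<lambda>t. \<phi> (h \<otimes>\<^bsub>G\<^esub> inv_into U \<phi> ((\<phi> \<one>\<^bsub>G\<^esub>)(j := t)) \<otimes>\<^bsub>G\<^esub> inv\<^bsub>G\<^esub> h) i) (\<phi> \<one>\<^bsub>G\<^esub> j)"

definition root :: "nat \<Rightarrow> 'g lie_group \<Rightarrow> 'g set \<Rightarrow> ('g \<Rightarrow> complex) \<Rightarrow> bool" where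
  "root d G T \<alpha> \<longleftrightarrow> character G T \<alpha> \<and> (\<exists>t\<in>T. \<alpha> t \<noteq> 1) \<and>
     (\<exists>(U, \<phi>)\<in>atlas G. \<one>\<^bsub>G\<^esub> \<in> U \<and>
        (\<exists>X::nat \<Rightarrow> complex. (\<exists>i<d. X i \<noteq> 0) \<and>
           (\<forall>t\<in>T. \<forall>i<d. (\<Sum>j<d. of_real (Ad_entry G U \<phi> t i j) * X j) = \<alpha> t * X i)))"

text \<open>
  The Lie algebra of \<open>T\<close> is represented by the one-parameter subgroups of \<open>T\<close>, and
  \<open>pairing \<nu> \<gamma>\<close> is the value at \<open>\<gamma>\<close> of the real linear form \<open>d\<nu> / \<i>\<close>.
\<close>

definition one_parameter_subgroup :: "'g lie_group \<Rightarrow> 'g set \<Rightarrow> (real \<Rightarrow> 'g) \<Rightarrow> bool" where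
  "one_parameter_subgroup G T \<gamma> \<longleftrightarrow>
     continuous_map euclideanreal (subtopology (gtop G) T) \<gamma> \<and>
     (\<forall>s t. \<gamma> (s + t) = \<gamma> s \<otimes>\<^bsub>G\<^esub> \<gamma> t)"

definition pairing :: "('g \<Rightarrow> complex) \<Rightarrow> (real \<Rightarrow> 'g) \<Rightarrow> real" where
  "pairing \<nu> \<gamma> = (THE a. \<forall>s. \<nu> (\<gamma> s) = cis (a * s))"

text \<open>
  A Weyl chamber is a connected component of the complement of the root hyperplanes in the Lie
  algebra of \<open>T\<close>: all elements that no root hyperplane separates from a given regular element.
\<close>

definition weyl_chamber ::
  "nat \<Rightarrow> 'g lie_group \<Rightarrow> 'g set \<Rightarrow> (real \<Rightarrow> 'g) set \<Rightarrow> bool" where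
  "weyl_chamber d G T C \<longleftrightarrow>
     (\<exists>\<gamma>\<^sub>0. one_parameter_subgroup G T \<gamma>\<^sub>0 \<and> (\<forall>\<alpha>. root d G T \<alpha> \<longrightarrow> pairing \<alpha> \<gamma>\<^sub>0 \<noteq> 0) \<and>
        C = {\<gamma>. one_parameter_subgroup G T \<gamma> \<and>
                (\<forall>\<alpha>. root d G T \<alpha> \<longrightarrow> sgn (pairing \<alpha> \<gamma>) = sgn (pairing \<alpha> \<gamma>\<^sub>0))})"

definition positive_root ::
  "nat \<Rightarrow> 'g lie_group \<Rightarrow> 'g set \<Rightarrow> (real \<Rightarrow> 'g) set \<Rightarrow> ('g \<Rightarrow> complex) \<Rightarrow> bool" where
  "positive_root d G T C \<alpha> \<longleftrightarrow> root d G T \<alpha> \<and> (\<forall>\<gamma>\<in>C. pairing \<alpha> \<gamma> > 0)"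

section \<open>Representations\<close>

text \<open>
  All complex vector spaces below are subspaces of function spaces \<open>'c \<Rightarrow> complex\<close>
  with the pointwise operations.
\<close>

definition cscale :: "complex \<Rightarrow> ('c \<Rightarrow> complex) \<Rightarrow> 'c \<Rightarrow> complex" where
  "cscale a f = (\<lambda>x. a * f x)"

global_interpretation cfun: vector_space cscale
  by unfold_locales (auto simp: cscale_def algebra_simps fun_eq_iff)

text \<open>
  The dimension with values in \<open>[0, \<infinity>]\<close>; the library's \<open>dim\<close> would be 0 for spaces of infinite
  dimension.
\<close>

definition edim :: "('c \<Rightarrow> complex) set \<Rightarrow> ennreal" where
  "edim W = (SUP B\<in>{B. B \<subseteq> W \<and> finite B \<and> \<not> cfun.dependent B}. of_nat (card B))"

text \<open>
  Finite-dimensional continuous representations. On such a space the pointwise topology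
  is the usual one.
\<close>

definition representation ::
  "'g lie_group \<Rightarrow> ('c \<Rightarrow> complex) set \<Rightarrow> ('g \<Rightarrow> ('c \<Rightarrow> complex) \<Rightarrow> 'c \<Rightarrow> complex) \<Rightarrow> bool" where
  "representation G V \<rho> \<longleftrightarrow>
     cfun.subspace V \<and> (\<exists>B. finite B \<and> V = cfun.span B) \<and>
     (\<forall>h\<in>carrier G. \<forall>v\<in>V. \<rho> h v \<in> V) \<and>
     (\<forall>h\<in>carrier G. \<forall>v\<in>V. \<forall>w\<in>V. \<rho> h (v + w) = \<rho> h v + \<rho> h w) \<and>
     (\<forall>h\<in>carrier G. \<forall>a. \<forall>v\<in>V. \<rho> h (cscale a v) = cscale a (\<rho> h v)) \<and>
     (\<forall>v\<in>V. \<rho> \<one>\<^bsub>G\<^esub> v = v) \<and>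
     (\<forall>h\<in>carrier G. \<forall>k\<in>carrier G. \<forall>v\<in>V. \<rho> (h \<otimes>\<^bsub>G\<^esub> k) v = \<rho> h (\<rho> k v)) \<and>
     (\<forall>v\<in>V. \<forall>x. continuous_map (gtop G) euclidean (\<lambda>h. \<rho> h v x))"

definition irreducible_representation ::
  "'g lie_group \<Rightarrow> ('c \<Rightarrow> complex) set \<Rightarrow> ('g \<Rightarrow> ('c \<Rightarrow> complex) \<Rightarrow> 'c \<Rightarrow> complex) \<Rightarrow> bool" where
  "irreducible_representation G V \<rho> \<longleftrightarrow>
     representation G V \<rho> \<and> V \<noteq> {0} \<and>
     (\<forall>W. cfun.subspace W \<and> W \<subseteq> V \<and> (\<forall>h\<in>carrier G. \<forall>w\<in>W. \<rho> h w \<in> W) \<longrightarrow> W = {0} \<or> W = V)"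

definition weight ::
  "'g lie_group \<Rightarrow> 'g set \<Rightarrow> ('c \<Rightarrow> complex) set \<Rightarrow> ('g \<Rightarrow> ('c \<Rightarrow> complex) \<Rightarrow> 'c \<Rightarrow> complex) \<Rightarrow>
   ('g \<Rightarrow> complex) \<Rightarrow> bool" where
  "weight G T V \<rho> \<nu> \<longleftrightarrow> character G T \<nu> \<and> (\<exists>v\<in>V. v \<noteq> 0 \<and> (\<forall>t\<in>T. \<rho> t v = cscale (\<nu> t) v))"

text \<open>
  The usual order on weights: \<open>\<mu> - \<nu>\<close> is a sum of positive roots. Characters are
  written multiplicatively.
\<close>

definition highest_weight ::
  "nat \<Rightarrow> 'g lie_group \<Rightarrow> 'g set \<Rightarrow> (real \<Rightarrow> 'g) set \<Rightarrow>
   ('c \<Rightarrow> complex) set \<Rightarrow> ('g \<Rightarrow> ('c \<Rightarrow> complex) \<Rightarrow> 'c \<Rightarrow> complex) \<Rightarrow> ('g \<Rightarrow> complex) \<Rightarrow> bool" where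
  "highest_weight d G T C V \<rho> \<mu> \<longleftrightarrow>
     weight G T V \<rho> \<mu> \<and>
     (\<forall>\<nu>. weight G T V \<rho> \<nu> \<longrightarrow>
        (\<exists>\<alpha>s. (\<forall>\<alpha>\<in>set \<alpha>s. positive_root d G T C \<alpha>) \<and>
              (\<forall>t\<in>T. \<mu> t = \<nu> t * (\<Prod>\<alpha>\<leftarrow>\<alpha>s. \<alpha> t))))"

definition rep_isomorphic ::
  "'g lie_group \<Rightarrow> ('c \<Rightarrow> complex) set \<Rightarrow> ('g \<Rightarrow> ('c \<Rightarrow> complex) \<Rightarrow> 'c \<Rightarrow> complex) \<Rightarrow>
   ('e \<Rightarrow> complex) set \<Rightarrow> ('g \<Rightarrow> ('e \<Rightarrow> complex) \<Rightarrow> 'e \<Rightarrow> complex) \<Rightarrow> bool" where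
  "rep_isomorphic G V \<rho> W \<pi> \<longleftrightarrow>
     (\<exists>f. bij_betw f V W \<and>
        (\<forall>v\<in>V. \<forall>w\<in>V. f (v + w) = f v + f w) \<and>
        (\<forall>a. \<forall>v\<in>V. f (cscale a v) = cscale a (f v)) \<and>
        (\<forall>h\<in>carrier G. \<forall>v\<in>V. f (\<rho> h v) = \<pi> h (f v)))"

definition isotypic_component ::
  "'g lie_group \<Rightarrow> ('c \<Rightarrow> complex) set \<Rightarrow> ('g \<Rightarrow> ('c \<Rightarrow> complex) \<Rightarrow> 'c \<Rightarrow> complex) \<Rightarrow>
   ('e \<Rightarrow> complex) set \<Rightarrow> ('g \<Rightarrow> ('e \<Rightarrow> complex) \<Rightarrow> 'e \<Rightarrow> complex) \<Rightarrow> ('e \<Rightarrow> complex) set" where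
  "isotypic_component G V \<rho> H \<pi> =
     cfun.span (\<Union>{W. cfun.subspace W \<and> W \<subseteq> H \<and> rep_isomorphic G V \<rho> W \<pi>})"

section \<open>Complex projective varieties\<close>

text \<open>
  The points of the projective space of dimension \<open>CARD('m) - 1\<close> are the lines in
  \<open>complex ^ 'm\<close>; its topology is the quotient topology.
\<close>

type_synonym 'm ppoint = "(complex ^ 'm) set"

definition line :: "complex ^ 'm \<Rightarrow> 'm ppoint" where
  "line v = range (\<lambda>c. c *s v)"

definition proj_space :: "'m::finite ppoint set" where
  "proj_space = line ` (- {0})"

definition proj_top :: "'m::finite ppoint topology" where
  "proj_top = topology (\<lambda>U. U \<subseteq> proj_space \<and> open {v. v \<noteq> 0 \<and> line v \<in> U})"

lemma openin_proj_top:
  fixes U :: "'m::finite ppoint set"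
  shows "openin proj_top U \<longleftrightarrow> U \<subseteq> proj_space \<and> open {v. v \<noteq> 0 \<and> line v \<in> U}"
proof -
  have "istopology (\<lambda>U :: 'm ppoint set. U \<subseteq> proj_space \<and> open {v. v \<noteq> 0 \<and> line v \<in> U})"
    unfolding istopology_def
  proof (intro conjI allI impI)
    fix S T :: "'m ppoint set"
    assume S: "S \<subseteq> proj_space \<and> open {v. v \<noteq> 0 \<and> line v \<in> S}"
      and T: "T \<subseteq> proj_space \<and> open {v. v \<noteq> 0 \<and> line v \<in> T}"
    show "S \<inter> T \<subseteq> proj_space" using S by blast
    have "{v. v \<noteq> 0 \<and> line v \<in> S \<inter> T} = {v. v \<noteq> 0 \<and> line v \<in> S} \<inter> {v. v \<noteq> 0 \<and> line v \<in> T}"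
      by blast
    with S T show "open {v. v \<noteq> 0 \<and> line v \<in> S \<inter> T}" by (simp add: open_Int)
  next
    fix \<U> :: "'m ppoint set set"
    assume *: "\<forall>U\<in>\<U>. U \<subseteq> proj_space \<and> open {v. v \<noteq> 0 \<and> line v \<in> U}"
    show "\<Union>\<U> \<subseteq> proj_space" using * by blast
    have "{v. v \<noteq> 0 \<and> line v \<in> \<Union>\<U>} = (\<Union>U\<in>\<U>. {v. v \<noteq> 0 \<and> line v \<in> U})"
      by blast
    with * show "open {v. v \<noteq> 0 \<and> line v \<in> \<Union>\<U>}" by (simp add: open_UN)
  qed
  then show ?thesis
    unfolding proj_top_def by (simp add: topology_inverse')
qed

abbreviation top_on :: "'m::finite ppoint set \<Rightarrow> 'm ppoint topology" where
  "top_on M \<equiv> subtopology proj_top M"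

definition homogeneous_polynomial :: "nat \<Rightarrow> (complex ^ 'm::finite \<Rightarrow> complex) \<Rightarrow> bool" where
  "homogeneous_polynomial d f \<longleftrightarrow>
     (\<exists>(S :: ('m \<Rightarrow> nat) set) c. finite S \<and> (\<forall>e\<in>S. (\<Sum>i\<in>UNIV. e i) = d) \<and>
        f = (\<lambda>v. \<Sum>e\<in>S. c e * (\<Prod>i\<in>UNIV. (v $ i) ^ e i)))"

definition algebraic_set :: "'m::finite ppoint set \<Rightarrow> bool" where
  "algebraic_set M \<longleftrightarrow>
     (\<exists>F. (\<forall>f\<in>F. \<exists>d. homogeneous_polynomial d f) \<and>
          M = {line v |v. v \<noteq> 0 \<and> (\<forall>f\<in>F. f v = 0)})"

definition holomorphic_fun_on :: "(complex ^ 'm::finite \<Rightarrow> complex) \<Rightarrow> (complex ^ 'm) set \<Rightarrow> bool" where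
  "holomorphic_fun_on F W \<longleftrightarrow>
     (\<forall>w\<in>W. \<exists>F'. (F has_derivative F') (at w) \<and> (\<forall>c u. F' (c *s u) = c * F' u))"

text \<open>
  The structure sheaf of the reduced complex space \<open>M\<close>: functions that locally are restrictions
  of holomorphic functions on the ambient projective space, written in homogeneous coordinates.
\<close>

definition holo :: "'m::finite ppoint set \<Rightarrow> ('m ppoint \<Rightarrow> complex) \<Rightarrow> bool" where
  "holo U f \<longleftrightarrow>
     (\<forall>v. v \<noteq> 0 \<and> line v \<in> U \<longrightarrow>
        (\<exists>W F. open W \<and> v \<in> W \<and> holomorphic_fun_on F W \<and>
           (\<forall>w\<in>W. w \<noteq> 0 \<and> line w \<in> U \<longrightarrow> F w = f (line w))))"

definition analytic_subset :: "'m::finite ppoint set \<Rightarrow> 'm ppoint set \<Rightarrow> bool" where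
  "analytic_subset M A \<longleftrightarrow> A \<subseteq> M \<and>
     (\<forall>x\<in>M. \<exists>U F. openin (top_on M) U \<and> x \<in> U \<and> finite F \<and> (\<forall>f\<in>F. holo U f) \<and>
        A \<inter> U = {y \<in> U. \<forall>f\<in>F. f y = 0})"

text \<open>
  Varieties are irreducible, in the sense of complex spaces. By Chow's theorem the analytic
  subsets of a projective algebraic set are exactly its algebraic subsets, so that this is also
  irreducibility in the Zariski topology.
\<close>

definition projective_variety :: "'m::finite ppoint set \<Rightarrow> bool" where
  "projective_variety M \<longleftrightarrow> algebraic_set M \<and> M \<noteq> {} \<and>
     (\<forall>A B. analytic_subset M A \<and> analytic_subset M B \<and> A \<union> B = M \<longrightarrow> A = M \<or> B = M)"

text \<open>The dimension: the maximal length of a chain of irreducible closed subvarieties.\<close>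

definition variety_dim :: "'m::finite ppoint set \<Rightarrow> enat" where
  "variety_dim M = Sup {enat d |d. \<exists>Z :: nat \<Rightarrow> 'm ppoint set.
     (\<forall>i\<le>d. projective_variety (Z i)) \<and> (\<forall>i<d. Z i \<subset> Z (Suc i)) \<and> Z d \<subseteq> M}"

definition holomorphic_map ::
  "'m::finite ppoint set \<Rightarrow> 'm ppoint set \<Rightarrow> ('m ppoint \<Rightarrow> 'm ppoint) \<Rightarrow> bool" where
  "holomorphic_map M N \<phi> \<longleftrightarrow> continuous_map (top_on M) (top_on N) \<phi> \<and>
     (\<forall>U f. openin (top_on N) U \<and> holo U f \<longrightarrow> holo {x \<in> M. \<phi> x \<in> U} (\<lambda>x. f (\<phi> x)))"

text \<open>
  A holomorphic action of the (real) Lie group \<open>G\<close> is a continuous action by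
  holomorphic automorphisms.
\<close>

definition holomorphic_action ::
  "'g lie_group \<Rightarrow> 'm::finite ppoint set \<Rightarrow> ('g \<Rightarrow> 'm ppoint \<Rightarrow> 'm ppoint) \<Rightarrow> bool" where
  "holomorphic_action G M act \<longleftrightarrow> group_action G M act \<and>
     (\<forall>h\<in>carrier G. holomorphic_map M M (act h)) \<and>
     continuous_map (prod_topology (gtop G) (top_on M)) (top_on M) (\<lambda>(h, x). act h x)"

section \<open>Linearized line bundles\<close>

text \<open>
  A \<open>G\<close>-linearized line bundle is given in terms of trivializations
  \<open>\<psi>\<^sub>i : L|\<^bsub>U\<^sub>i\<^esub> \<rightarrow> U\<^sub>i \<times> \<complex>\<close> over an open cover.
  \<^item> \<open>trans_fun L i j\<close> is the transition function: a vector over \<open>x\<close> with coordinate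
    \<open>z\<close> in the trivialization \<open>j\<close> has coordinate \<open>trans_fun L i j x * z\<close> in the trivialization
    \<open>i\<close>.
  \<^item> \<open>lift L i j h\<close> describes the action of \<open>h\<close> on the total space, a lift of its action on \<open>M\<close>
    that is linear on fibres: the vector over \<open>x\<close> with coordinate \<open>z\<close> in the trivialization \<open>j\<close>
    is mapped to the vector over \<open>act h x\<close> with coordinate \<open>lift L i j h x * z\<close> in the
    trivialization \<open>i\<close>.
\<close>

record ('g, 'i, 'm) lin_bundle =
  indices :: "'i set"
  cover :: "'i \<Rightarrow> 'm ppoint set"
  trans_fun :: "'i \<Rightarrow> 'i \<Rightarrow> 'm ppoint \<Rightarrow> complex"
  lift :: "'i \<Rightarrow> 'i \<Rightarrow> 'g \<Rightarrow> 'm ppoint \<Rightarrow> complex"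

definition line_bundle ::
  "'m::finite ppoint set \<Rightarrow> ('g, 'i, 'm) lin_bundle \<Rightarrow> bool" where
  "line_bundle M L \<longleftrightarrow>
     (\<forall>i\<in>indices L. openin (top_on M) (cover L i)) \<and>
     (\<Union>i\<in>indices L. cover L i) = M \<and>
     (\<forall>i\<in>indices L. \<forall>j\<in>indices L. holo (cover L i \<inter> cover L j) (trans_fun L i j)) \<and>
     (\<forall>i\<in>indices L. \<forall>j\<in>indices L. \<forall>x\<in>cover L i \<inter> cover L j. trans_fun L i j x \<noteq> 0) \<and>
     (\<forall>i\<in>indices L. \<forall>x\<in>cover L i. trans_fun L i i x = 1) \<and>
     (\<forall>i\<in>indices L. \<forall>j\<in>indices L. \<forall>k\<in>indices L. \<forall>x\<in>cover L i \<inter> cover L j \<inter> cover L k.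
        trans_fun L i j x * trans_fun L j k x = trans_fun L i k x)"

definition linearized_line_bundle ::
  "'g lie_group \<Rightarrow> 'm::finite ppoint set \<Rightarrow> ('g \<Rightarrow> 'm ppoint \<Rightarrow> 'm ppoint) \<Rightarrow>
   ('g, 'i, 'm) lin_bundle \<Rightarrow> bool" where
  "linearized_line_bundle G M act L \<longleftrightarrow> line_bundle M L \<and>
     \<comment> \<open>the lifts are well defined on the total space\<close>
     (\<forall>i\<in>indices L. \<forall>i'\<in>indices L. \<forall>j\<in>indices L. \<forall>j'\<in>indices L. \<forall>h\<in>carrier G.
        \<forall>x\<in>cover L j \<inter> cover L j'. act h x \<in> cover L i \<inter> cover L i' \<longrightarrow>
          lift L i j h x =
            trans_fun L i i' (act h x) * lift L i' j' h x * trans_fun L j' j x) \<and>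
     \<comment> \<open>they form a group action\<close>
     (\<forall>i\<in>indices L. \<forall>x\<in>cover L i. lift L i i \<one>\<^bsub>G\<^esub> x = 1) \<and>
     (\<forall>i\<in>indices L. \<forall>j\<in>indices L. \<forall>k\<in>indices L. \<forall>h\<in>carrier G. \<forall>h'\<in>carrier G.
        \<forall>x\<in>cover L k. act h' x \<in> cover L j \<and> act h (act h' x) \<in> cover L i \<longrightarrow>
          lift L i k (h \<otimes>\<^bsub>G\<^esub> h') x = lift L i j h (act h' x) * lift L j k h' x) \<and>
     \<comment> \<open>by holomorphic transformations, continuously\<close>
     (\<forall>i\<in>indices L. \<forall>j\<in>indices L. \<forall>h\<in>carrier G.
        holo {x \<in> cover L j. act h x \<in> cover L i} (lift L i j h)) \<and>
     (\<forall>i\<in>indices L. \<forall>j\<in>indices L.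
        continuous_map
          (subtopology (prod_topology (gtop G) (top_on M))
             {(h, x). x \<in> cover L j \<and> act h x \<in> cover L i})
          euclidean (\<lambda>(h, x). lift L i j h x))"

definition tensor_power ::
  "('g, 'i, 'm) lin_bundle \<Rightarrow> nat \<Rightarrow> ('g, 'i, 'm) lin_bundle" where
  "tensor_power L k =
     L\<lparr>trans_fun := (\<lambda>i j x. trans_fun L i j x ^ k), lift := (\<lambda>i j h x. lift L i j h x ^ k)\<rparr>"

text \<open>
  A section is the family of its coordinate functions, set to 0 outside the sets where they are
  defined.
\<close>

definition sections ::
  "('g, 'i, 'm::finite) lin_bundle \<Rightarrow> ('i \<times> 'm ppoint \<Rightarrow> complex) set" where
  "sections L =
     {s. (\<forall>i x. \<not> (i \<in> indices L \<and> x \<in> cover L i) \<longrightarrow> s (i, x) = 0) \<and>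
         (\<forall>i\<in>indices L. holo (cover L i) (\<lambda>x. s (i, x))) \<and>
         (\<forall>i\<in>indices L. \<forall>j\<in>indices L. \<forall>x\<in>cover L i \<inter> cover L j.
            s (i, x) = trans_fun L i j x * s (j, x))}"

text \<open>
  \<open>G\<close> acts on sections by \<open>(h \<cdot> s) x = h \<cdot> s (h\<^sup>-\<^sup>1 \<cdot> x)\<close>; the choice of a
  trivialization at \<open>h\<^sup>-\<^sup>1 \<cdot> x\<close> does not matter.
\<close>

definition section_action ::
  "'g lie_group \<Rightarrow> ('g \<Rightarrow> 'm ppoint \<Rightarrow> 'm ppoint) \<Rightarrow> ('g, 'i, 'm::finite) lin_bundle \<Rightarrow>
   'g \<Rightarrow> ('i \<times> 'm ppoint \<Rightarrow> complex) \<Rightarrow> 'i \<times> 'm ppoint \<Rightarrow> complex" where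
  "section_action G act L h s =
     (\<lambda>(i, x). if i \<in> indices L \<and> x \<in> cover L i
        then let y = act (inv\<^bsub>G\<^esub> h) x; j = (SOME j. j \<in> indices L \<and> y \<in> cover L j)
             in lift L i j h y * s (j, y)
        else 0)"

definition invariant_sections ::
  "'g lie_group \<Rightarrow> ('g \<Rightarrow> 'm ppoint \<Rightarrow> 'm ppoint) \<Rightarrow> ('g, 'i, 'm::finite) lin_bundle \<Rightarrow>
   ('i \<times> 'm ppoint \<Rightarrow> complex) set" where
  "invariant_sections G act L = {s \<in> sections L. \<forall>h\<in>carrier G. section_action G act L h s = s}"

definition G_exponent ::
  "'g lie_group \<Rightarrow> ('g \<Rightarrow> 'm ppoint \<Rightarrow> 'm ppoint) \<Rightarrow> ('g, 'i, 'm::finite) lin_bundle \<Rightarrow> nat" where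
  "G_exponent G act L = Gcd {m. invariant_sections G act (tensor_power L m) \<noteq> {0}}"

text \<open>
  \<open>vol_isotypic n g G act V \<rho> L\<close> is \<open>vol\<^sub>\<mu>(L)\<close> for the irreducible representation \<open>(V, \<rho>)\<close> of
  highest weight \<open>\<mu>\<close>, where \<open>n = dim M\<close> and \<open>g = dim G\<close>.
\<close>

definition vol_isotypic ::
  "nat \<Rightarrow> nat \<Rightarrow> 'g lie_group \<Rightarrow> ('g \<Rightarrow> 'm ppoint \<Rightarrow> 'm ppoint) \<Rightarrow>
   ('c \<Rightarrow> complex) set \<Rightarrow> ('g \<Rightarrow> ('c \<Rightarrow> complex) \<Rightarrow> 'c \<Rightarrow> complex) \<Rightarrow>
   ('g, 'i, 'm::finite) lin_bundle \<Rightarrow> ennreal" where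
  "vol_isotypic n g G act V \<rho> L =
     limsup (\<lambda>k. ennreal (fact (n - g) / real k ^ (n - g)) *
       edim (isotypic_component G V \<rho> (sections (tensor_power L k))
               (section_action G act (tensor_power L k))))"

end

theory Submission
  imports Defs
begin

text \<open>
  Let \<open>f k\<close> be the dimension of the \<open>V\<close>-isotypic component of the sections of \<open>L\<^sup>k\<close>, and let \<open>S\<close>
  be the set of all \<open>m\<close> such that \<open>L\<^sup>m\<close> has a nonzero invariant section. Multiplication by such a
  section is an equivariant linear map from the sections of \<open>L\<^sup>k\<close> to those of
  \<open>L\<^sup>k\<^sup>+\<^sup>m\<close>; it is injective, because two proper analytic subsets (the zero sets
  of the two factors) cannot cover the irreducible variety \<open>M\<close>. Hence \<open>f k \<le> f (k + m)\<close> for all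
  \<open>m \<in> S\<close> (\<open>isotypic_dimension_mono\<close>), and \<open>S\<close> is closed under addition
  (\<open>invariant_exponents_add\<close>).

  The volume of \<open>L\<^sup>p\<close> is, up to the factor \<open>p ^ (n - g)\<close>, the upper limit of
  \<open>(n - g)! * f k / k ^ (n - g)\<close> along the multiples of \<open>p\<close>, so the issue is that the other \<open>k\<close>
  contribute nothing more. As \<open>p\<close> is coprime to the greatest common divisor of the additive semigroup
  \<open>S\<close>, every residue class modulo \<open>p\<close> contains an element of \<open>S\<close>
  (\<open>additive_semigroup_meets_residues\<close>). Choosing one element for each class, one can move from
  any \<open>k\<close> to a multiple of \<open>p\<close> by adding an element of \<open>S\<close> of bounded size. This does not
  decrease \<open>f\<close>, and it changes \<open>k ^ (n - g)\<close> by a factor that tends to 1, so that both upper limits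
  agree (\<open>limsup_along_multiples\<close>).
\<close>

section \<open>Additive semigroups of natural numbers\<close>

lemma additive_semigroup_multiple:
  fixes S :: "nat set"
  assumes "\<And>a b. a \<in> S \<Longrightarrow> b \<in> S \<Longrightarrow> a + b \<in> S" and "m \<in> S" and "q \<ge> 1"
  shows "q * m \<in> S"
  using \<open>q \<ge> 1\<close>
proof (induction q rule: dec_induct)
  case base
  then show ?case using assms by simp
next
  case (step q)
  then show ?case using assms by simp
qed

text \<open>
  Modulo \<open>p\<close> the elements of \<open>S\<close> form a subsemigroup of a finite group, hence a subgroup. It is
  generated by its least positive representative \<open>d\<close>, and \<open>d\<close> divides \<open>p\<close> and all of \<open>S\<close>;
  by coprimality \<open>d = 1\<close>, so that the subgroup is everything.
\<close>

lemma additive_semigroup_meets_residues: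
  fixes S :: "nat set"
  assumes add: "\<And>a b. a \<in> S \<Longrightarrow> b \<in> S \<Longrightarrow> a + b \<in> S" and "S \<noteq> {}"
    and "p \<ge> 1" and "coprime p (Gcd S)"
  shows "\<exists>m\<in>S. p dvd k + m"
proof -
  define H where "H = {a. \<exists>m\<in>S. m mod p = a mod p}"
  have mult: "q * m \<in> S" if "m \<in> S" "q \<ge> 1" for q m
    using additive_semigroup_multiple[of S, OF add that] by blast
  have "p \<in> H"
  proof -
    obtain m where "m \<in> S" using \<open>S \<noteq> {}\<close> by blast
    then have "p * m \<in> S" using mult \<open>p \<ge> 1\<close> by blast
    moreover have "(p * m) mod p = p mod p" by simp
    ultimately show ?thesis unfolding H_def by blast
  qed
  define d where "d = (LEAST a. a \<in> H \<and> a > 0)"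
  have "d \<in> H \<and> d > 0"
    unfolding d_def by (rule LeastI[of _ p]) (use \<open>p \<in> H\<close> \<open>p \<ge> 1\<close> in auto)
  then have "d \<in> H" "d > 0" by auto
  then obtain m\<^sub>0 where m0: "m\<^sub>0 \<in> S" "m\<^sub>0 mod p = d mod p"
    unfolding H_def by blast
  have dvd_H: "d dvd a" if a: "a \<in> H" for a
  proof -
    obtain m where m: "m \<in> S" "m mod p = a mod p" using a unfolding H_def by blast
    \<comment> \<open>Subtraction of \<open>q * d\<close> modulo \<open>p\<close> is addition of \<open>q * (p - 1)\<close> copies of \<open>d\<close>; the further
      \<open>p\<close> copies only make their number positive.\<close>
    define q where "q = a div d"
    have "m + (q * (p - 1) + p) * m\<^sub>0 \<in> S"
      using add[OF m(1) mult[OF m0(1)]] \<open>p \<ge> 1\<close> by simp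
    moreover have "(m + (q * (p - 1) + p) * m\<^sub>0) mod p = (a mod d) mod p"
    proof -
      have "(m + (q * (p - 1) + p) * m\<^sub>0) mod p = (a + (q * (p - 1) + p) * d) mod p"
        by (rule mod_add_cong[OF m(2) mod_mult_cong[OF refl m0(2)]])
      also have "a + (q * (p - 1) + p) * d = a mod d + p * (q * d + d)"
      proof -
        have "a = q * d + a mod d" unfolding q_def by simp
        moreover have "(q * (p - 1) + p) * d + q * d = p * (q * d + d)"
          using \<open>p \<ge> 1\<close> by (cases p) (auto simp: algebra_simps)
        ultimately show ?thesis by linarith
      qed
      finally show ?thesis by simp
    qed
    ultimately have "a mod d \<in> H" unfolding H_def by blast
    moreover have "a mod d < d" using \<open>d > 0\<close> by simp
    ultimately have "a mod d = 0"
      using not_less_Least[of "a mod d" "\<lambda>a. a \<in> H \<and> a > 0"] unfolding d_def by auto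
    then show ?thesis by auto
  qed
  have "d dvd Gcd S"
    by (rule Gcd_greatest) (use dvd_H in \<open>auto simp: H_def\<close>)
  with dvd_H[OF \<open>p \<in> H\<close>] have "d = 1"
    using \<open>coprime p (Gcd S)\<close> by (meson coprime_common_divisor_nat nat_dvd_1_iff_1)
  have "(k * (p - 1) + p) * m\<^sub>0 \<in> S"
    by (rule mult[OF m0(1)]) (use \<open>p \<ge> 1\<close> in simp)
  moreover have "(k + (k * (p - 1) + p) * m\<^sub>0) mod p = 0"
  proof -
    have "(k + (k * (p - 1) + p) * m\<^sub>0) mod p = (k + (k * (p - 1) + p) * 1) mod p"
      by (rule mod_add_cong[OF refl mod_mult_cong[OF refl m0(2)[unfolded \<open>d = 1\<close>]]])
    also have "k + (k * (p - 1) + p) * 1 = p * (k + 1)"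
      using \<open>p \<ge> 1\<close> by (cases p) (auto simp: algebra_simps)
    finally show ?thesis by simp
  qed
  ultimately show ?thesis by auto
qed

section \<open>Upper limits along multiples\<close>

lemma limsup_cmult_ennreal:
  fixes u :: "nat \<Rightarrow> ennreal" and c :: ennreal
  assumes "c < \<infinity>"
  shows "limsup (\<lambda>k. c * u k) = c * limsup u"
  by (rule Limsup_compose_continuous_mono[where f = "\<lambda>x. c * x"])
    (use assms in \<open>auto intro!: ennreal_continuous_on_cmult continuous_on_id mult_left_mono simp: mono_def\<close>)

lemma le_if_le_mult_gt_1:
  fixes x y :: ennreal
  assumes "\<And>c. c > (1::real) \<Longrightarrow> x \<le> ennreal c * y"
  shows "x \<le> y"
proof (cases "y = \<infinity>")
  case False
  show ?thesis
  proof (rule LIMSEQ_le_const)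
    have "(\<lambda>k. ennreal (1 + 1 / real (Suc k))) \<longlonglongrightarrow> ennreal (1 + 0)"
      by (intro tendsto_ennrealI tendsto_add tendsto_const LIMSEQ_Suc[OF lim_1_over_n])
    then have "(\<lambda>k. y * ennreal (1 + 1 / real (Suc k))) \<longlonglongrightarrow> y * ennreal (1 + 0)"
      using False by (intro ennreal_tendsto_cmult) (auto simp: less_top)
    then show "(\<lambda>k. ennreal (1 + 1 / real (Suc k)) * y) \<longlonglongrightarrow> y"
      by (simp add: mult.commute)
    show "\<exists>N. \<forall>k\<ge>N. x \<le> ennreal (1 + 1 / real (Suc k)) * y"
      by (intro exI[of _ 0] allI impI assms) simp
  qed
qed simp

text \<open>
  If \<open>f k \<le> f (k + m)\<close> with \<open>m \<le> N\<close>, the normalized value at \<open>k\<close> exceeds the one at \<open>k + m\<close> at most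
  by the factor \<open>(1 + N / k) ^ d\<close>, which tends to 1.
\<close>

lemma limsup_along_multiples:
  fixes f :: "nat \<Rightarrow> ennreal"
  assumes step: "\<And>k. \<exists>m\<le>N. p dvd k + m \<and> f k \<le> f (k + m)" and "p \<ge> 1" and "c \<ge> 0"
  shows "limsup (\<lambda>k. ennreal (c / real k ^ d) * f (p * k)) =
           of_nat p ^ d * limsup (\<lambda>k. ennreal (c / real k ^ d) * f k)"
proof -
  define a where "a k = ennreal (c / real k ^ d) * f k" for k
  have "limsup a \<le> limsup (\<lambda>k. a (p * k))"
  proof (rule le_if_le_mult_gt_1)
    fix t :: real
    assume "t > 1"
    obtain m where m: "\<And>k. m k \<le> N" "\<And>k. p dvd k + m k" "\<And>k. f k \<le> f (k + m k)"
      using step by metis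
    define q where "q k = (k + m k) div p" for k
    have pq: "p * q k = k + m k" for k
      unfolding q_def using m(2) by simp
    have "(\<lambda>k. (1 + real N * (1 / real k)) ^ d) \<longlonglongrightarrow> (1 + real N * 0) ^ d"
      by (intro tendsto_intros lim_1_over_n)
    then have "\<forall>\<^sub>F k in sequentially. (1 + real N * (1 / real k)) ^ d < t"
      by (rule order_tendstoD) (use \<open>t > 1\<close> in simp)
    then have "\<forall>\<^sub>F k in sequentially. a k \<le> ennreal t * a (p * q k)"
      using eventually_gt_at_top[of 0]
    proof eventually_elim
      case (elim k)
      have "c / real k ^ d = (real (k + m k) / real k) ^ d * (c / real (k + m k) ^ d)"
        using \<open>k > 0\<close> by (simp add: power_divide)
      also have "\<dots> \<le> t * (c / real (k + m k) ^ d)"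
      proof (rule mult_right_mono)
        have "real (k + m k) / real k \<le> 1 + real N * (1 / real k)"
          using m(1)[of k] \<open>k > 0\<close> by (simp add: field_simps)
        then have "(real (k + m k) / real k) ^ d \<le> (1 + real N * (1 / real k)) ^ d"
          by (rule power_mono) simp
        then show "(real (k + m k) / real k) ^ d \<le> t" using elim by simp
      qed (use \<open>c \<ge> 0\<close> in simp)
      finally have "a k \<le> ennreal (t * (c / real (k + m k) ^ d)) * f (k + m k)"
        unfolding a_def by (intro mult_mono ennreal_leI m(3)) auto
      also have "\<dots> = ennreal t * a (p * q k)"
        unfolding a_def pq using \<open>t > 1\<close> by (subst ennreal_mult') (simp_all add: mult.assoc)
      finally show ?case .
    qed
    then have "limsup a \<le> limsup (\<lambda>k. ennreal t * a (p * q k))"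
      by (rule Limsup_mono)
    also have "\<dots> = ennreal t * limsup (\<lambda>k. a (p * q k))"
      by (rule limsup_cmult_ennreal) simp
    also have "\<dots> \<le> ennreal t * limsup (\<lambda>k. a (p * k))"
    proof (rule mult_left_mono)
      have "filterlim q sequentially sequentially"
        unfolding filterlim_at_top
      proof
        fix Z
        show "\<forall>\<^sub>F k in sequentially. Z \<le> q k"
          using eventually_ge_at_top[of "p * Z"]
        proof eventually_elim
          case (elim k)
          then have "p * Z \<le> p * q k" using pq[of k] by simp
          then show ?case using \<open>p \<ge> 1\<close> by simp
        qed
      qed
      have "limsup (\<lambda>k. a (p * q k)) \<le> Limsup (filtermap q sequentially) (\<lambda>k. a (p * k))"
        by (rule Limsup_filtermap_ge)
      also have "\<dots> \<le> limsup (\<lambda>k. a (p * k))"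
        using \<open>filterlim q sequentially sequentially\<close> unfolding filterlim_def Limsup_def
        by (intro INF_superset_mono) (auto dest: filter_leD)
      finally show "limsup (\<lambda>k. a (p * q k)) \<le> limsup (\<lambda>k. a (p * k))" .
    qed simp
    finally show "limsup a \<le> ennreal t * limsup (\<lambda>k. a (p * k))" .
  qed
  moreover have "limsup (\<lambda>k. a (p * k)) \<le> limsup a"
    using limsup_subseq_mono[of "\<lambda>k. p * k" a] \<open>p \<ge> 1\<close>
    by (auto simp: strict_mono_def comp_def)
  ultimately have eq: "limsup (\<lambda>k. a (p * k)) = limsup a" by (rule antisym[rotated])
  have "ennreal (c / real k ^ d) * f (p * k) = of_nat p ^ d * a (p * k)" for k
  proof -
    have "c / real k ^ d = real p ^ d * (c / real (p * k) ^ d)"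
      using \<open>p \<ge> 1\<close> by (simp add: power_mult_distrib)
    then have "ennreal (c / real k ^ d) = ennreal (real p ^ d) * ennreal (c / real (p * k) ^ d)"
      using \<open>c \<ge> 0\<close> by (metis ennreal_mult' of_nat_0_le_iff zero_le_power)
    then show ?thesis
      by (simp add: a_def mult.assoc ennreal_of_nat_eq_real_of_nat ennreal_power)
  qed
  then have "limsup (\<lambda>k. ennreal (c / real k ^ d) * f (p * k)) =
      limsup (\<lambda>k. of_nat p ^ d * a (p * k))"
    by simp
  also have "\<dots> = of_nat p ^ d * limsup (\<lambda>k. a (p * k))"
    by (rule limsup_cmult_ennreal) (simp add: ennreal_of_nat_eq_real_of_nat ennreal_power)
  finally show ?thesis unfolding eq by (simp add: a_def[abs_def])
qed

section \<open>Isotypic components under injective equivariant maps\<close>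

lemma edim_le_injective_image:
  assumes "Vector_Spaces.linear cscale cscale \<Phi>" and "cfun.subspace H" and "inj_on \<Phi> H"
    and "W \<subseteq> H" and "\<Phi> ` W \<subseteq> W'"
  shows "edim W \<le> edim W'"
proof -
  interpret pair: vector_space_pair cscale cscale by unfold_locales
  show ?thesis unfolding edim_def
  proof (rule SUP_mono)
    fix B assume "B \<in> {B. B \<subseteq> W \<and> finite B \<and> \<not> cfun.dependent B}"
    then have B: "B \<subseteq> W" "finite B" "\<not> cfun.dependent B" by auto
    then have inj: "inj_on \<Phi> (cfun.span B)"
      using assms by (meson cfun.span_minimal inj_on_subset order_trans)
    then have "\<not> cfun.dependent (\<Phi> ` B)"
      using pair.linear_independent_injective_image[OF assms(1)] B(3) by blast
    moreover have "card (\<Phi> ` B) = card B"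
      using inj by (meson card_image cfun.span_superset inj_on_subset)
    ultimately show "\<exists>B'\<in>{B. B \<subseteq> W' \<and> finite B \<and> \<not> cfun.dependent B}.
        (of_nat (card B) :: ennreal) \<le> of_nat (card B')"
      using B assms(5) by (intro bexI[of _ "\<Phi> ` B"]) auto
  qed
qed

lemma rep_isomorphic_injective_image:
  assumes "rep_isomorphic G V \<rho> W \<pi>" and "W \<subseteq> H" and "inj_on \<Phi> H"
    and lin: "Vector_Spaces.linear cscale cscale \<Phi>"
    and equi: "\<And>h t. h \<in> carrier G \<Longrightarrow> t \<in> H \<Longrightarrow> \<Phi> (\<pi> h t) = \<pi>' h (\<Phi> t)"
  shows "rep_isomorphic G V \<rho> (\<Phi> ` W) \<pi>'"
proof -
  obtain f where bij: "bij_betw f V W"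
    and add: "\<forall>v\<in>V. \<forall>w\<in>V. f (v + w) = f v + f w"
    and scale: "\<forall>a. \<forall>v\<in>V. f (cscale a v) = cscale a (f v)"
    and f_equi: "\<forall>h\<in>carrier G. \<forall>v\<in>V. f (\<rho> h v) = \<pi> h (f v)"
    using assms(1) unfolding rep_isomorphic_def by blast
  have fV: "f v \<in> H" if "v \<in> V" for v
    using bij that assms(2) by (auto simp: bij_betw_def)
  have "bij_betw \<Phi> W (\<Phi> ` W)"
    using assms(2,3) by (meson inj_on_imp_bij_betw inj_on_subset)
  then have "bij_betw (\<Phi> \<circ> f) V (\<Phi> ` W)"
    by (rule bij_betw_trans[OF bij])
  then show ?thesis
    unfolding rep_isomorphic_def using lin add scale f_equi equi fV
    by (intro exI[of _ "\<Phi> \<circ> f"]) (auto simp: Vector_Spaces.linear_iff)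
qed

text \<open>
  The map carries each copy of \<open>V\<close> in \<open>H\<close> onto a copy of \<open>V\<close> in \<open>H'\<close>, and therefore the
  span of the former into the span of the latter.
\<close>

lemma edim_isotypic_component_le:
  assumes lin: "Vector_Spaces.linear cscale cscale \<Phi>" and "cfun.subspace H" and "inj_on \<Phi> H"
    and "\<Phi> ` H \<subseteq> H'"
    and equi: "\<And>h t. h \<in> carrier G \<Longrightarrow> t \<in> H \<Longrightarrow> \<Phi> (\<pi> h t) = \<pi>' h (\<Phi> t)"
  shows "edim (isotypic_component G V \<rho> H \<pi>) \<le> edim (isotypic_component G V \<rho> H' \<pi>')"
proof (rule edim_le_injective_image[OF lin assms(2,3)])
  interpret pair: vector_space_pair cscale cscale by unfold_locales
  let ?U = "\<Union>{W. cfun.subspace W \<and> W \<subseteq> H \<and> rep_isomorphic G V \<rho> W \<pi>}"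
  let ?U' = "\<Union>{W. cfun.subspace W \<and> W \<subseteq> H' \<and> rep_isomorphic G V \<rho> W \<pi>'}"
  show "isotypic_component G V \<rho> H \<pi> \<subseteq> H"
    unfolding isotypic_component_def by (rule cfun.span_minimal[OF _ assms(2)]) blast
  have "\<Phi> ` W \<subseteq> ?U'" if "cfun.subspace W" "W \<subseteq> H" "rep_isomorphic G V \<rho> W \<pi>" for W
  proof -
    have "cfun.subspace (\<Phi> ` W)"
      using pair.linear_subspace_image[OF lin that(1)] .
    moreover have "\<Phi> ` W \<subseteq> H'" using that(2) assms(4) by blast
    moreover have "rep_isomorphic G V \<rho> (\<Phi> ` W) \<pi>'"
      by (rule rep_isomorphic_injective_image[OF that(3,2) assms(3) lin]) (rule equi)
    ultimately show ?thesis by blast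
  qed
  then have "\<Phi> ` ?U \<subseteq> ?U'" by blast
  then show "\<Phi> ` isotypic_component G V \<rho> H \<pi> \<subseteq> isotypic_component G V \<rho> H' \<pi>'"
    unfolding isotypic_component_def pair.linear_span_image[OF lin, symmetric]
    by (rule cfun.span_mono)
qed

section \<open>Products of sections\<close>

lemma holo_local:
  assumes "holo U f" and "v \<noteq> 0" and "line v \<in> U"
  obtains W F where "open W" and "v \<in> W" and "holomorphic_fun_on F W"
    and "\<And>w. w \<in> W \<Longrightarrow> w \<noteq> 0 \<Longrightarrow> line w \<in> U \<Longrightarrow> F w = f (line w)"
  using assms unfolding holo_def by meson

text \<open>
  The local extensions of \<open>f\<close> and \<open>g\<close> to the ambient space are combined on the common part of their
  domains; this serves for sums and for products.
\<close>

lemma holo_combine: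
  fixes U :: "'m::finite ppoint set"
  assumes "holo U f" and "holo U g"
    and "\<And>(F :: complex ^ 'm \<Rightarrow> complex) H W. holomorphic_fun_on F W \<Longrightarrow> holomorphic_fun_on H W \<Longrightarrow>
           holomorphic_fun_on (\<lambda>w. b (F w) (H w)) W"
  shows "holo U (\<lambda>x. b (f x) (g x))"
  unfolding holo_def
proof (intro allI impI)
  fix v assume v: "v \<noteq> 0 \<and> line v \<in> U"
  obtain W F where W: "open W" "v \<in> W" "holomorphic_fun_on F W"
    "\<And>w. w \<in> W \<Longrightarrow> w \<noteq> 0 \<Longrightarrow> line w \<in> U \<Longrightarrow> F w = f (line w)"
    using holo_local[OF assms(1)] v by metis
  obtain W' H where W': "open W'" "v \<in> W'" "holomorphic_fun_on H W'"
    "\<And>w. w \<in> W' \<Longrightarrow> w \<noteq> 0 \<Longrightarrow> line w \<in> U \<Longrightarrow> H w = g (line w)"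
    using holo_local[OF assms(2)] v by metis
  have "holomorphic_fun_on (\<lambda>w. b (F w) (H w)) (W \<inter> W')"
    by (rule assms(3)) (use W(3) W'(3) in \<open>auto simp: holomorphic_fun_on_def\<close>)
  then show "\<exists>W F. open W \<and> v \<in> W \<and> holomorphic_fun_on F W \<and>
      (\<forall>w\<in>W. w \<noteq> 0 \<and> line w \<in> U \<longrightarrow> F w = b (f (line w)) (g (line w)))"
    using W W' by (intro exI[of _ "W \<inter> W'"] exI[of _ "\<lambda>w. b (F w) (H w)"]) auto
qed

lemma holo_const: "holo U (\<lambda>x. a)"
  unfolding holo_def
proof (intro allI impI)
  fix v
  have "holomorphic_fun_on (\<lambda>w. a) UNIV"
    unfolding holomorphic_fun_on_def by (auto intro!: exI[of _ "\<lambda>_. 0"])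
  then show "\<exists>W F. open W \<and> v \<in> W \<and> holomorphic_fun_on F W \<and>
      (\<forall>w\<in>W. w \<noteq> 0 \<and> line w \<in> U \<longrightarrow> F w = a)"
    by (intro exI[of _ UNIV] exI[of _ "\<lambda>w. a"]) auto
qed

lemma holo_add:
  assumes "holo U f" and "holo U g"
  shows "holo U (\<lambda>x. f x + g x)"
proof (rule holo_combine[OF assms, where b = "(+)"])
  fix F H :: "complex ^ 'a \<Rightarrow> complex" and W
  assume *: "holomorphic_fun_on F W" "holomorphic_fun_on H W"
  show "holomorphic_fun_on (\<lambda>w. F w + H w) W"
    unfolding holomorphic_fun_on_def
  proof
    fix w assume "w \<in> W"
    then obtain F' H' where "(F has_derivative F') (at w)" "\<forall>c u. F' (c *s u) = c * F' u"
      "(H has_derivative H') (at w)" "\<forall>c u. H' (c *s u) = c * H' u"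
      using * unfolding holomorphic_fun_on_def by meson
    then show "\<exists>D. ((\<lambda>w. F w + H w) has_derivative D) (at w) \<and> (\<forall>c u. D (c *s u) = c * D u)"
      by (intro exI[of _ "\<lambda>u. F' u + H' u"]) (auto intro!: has_derivative_add simp: algebra_simps)
  qed
qed

lemma holo_mult:
  assumes "holo U f" and "holo U g"
  shows "holo U (\<lambda>x. f x * g x)"
proof (rule holo_combine[OF assms, where b = "(*)"])
  fix F H :: "complex ^ 'a \<Rightarrow> complex" and W
  assume *: "holomorphic_fun_on F W" "holomorphic_fun_on H W"
  show "holomorphic_fun_on (\<lambda>w. F w * H w) W"
    unfolding holomorphic_fun_on_def
  proof
    fix w assume "w \<in> W"
    then obtain F' H' where "(F has_derivative F') (at w)" "\<forall>c u. F' (c *s u) = c * F' u"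
      "(H has_derivative H') (at w)" "\<forall>c u. H' (c *s u) = c * H' u"
      using * unfolding holomorphic_fun_on_def by meson
    then show "\<exists>D. ((\<lambda>w. F w * H w) has_derivative D) (at w) \<and> (\<forall>c u. D (c *s u) = c * D u)"
      by (intro exI[of _ "\<lambda>u. F w * H' u + F' u * H w"])
        (auto intro: has_derivative_mult simp: distrib_left mult.left_commute mult.assoc)
  qed
qed

lemma tensor_power_simps [simp]:
  "indices (tensor_power L k) = indices L"
  "cover (tensor_power L k) = cover L"
  "trans_fun (tensor_power L k) i j x = trans_fun L i j x ^ k"
  "lift (tensor_power L k) i j h x = lift L i j h x ^ k"
  by (simp_all add: tensor_power_def)

lemma tensor_power_tensor_power: "tensor_power (tensor_power L p) k = tensor_power L (p * k)"
  by (simp add: tensor_power_def power_mult)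

lemma sectionsI:
  assumes "\<And>i x. \<not> (i \<in> indices L \<and> x \<in> cover L i) \<Longrightarrow> s (i, x) = 0"
    and "\<And>i. i \<in> indices L \<Longrightarrow> holo (cover L i) (\<lambda>x. s (i, x))"
    and "\<And>i j x. i \<in> indices L \<Longrightarrow> j \<in> indices L \<Longrightarrow> x \<in> cover L i \<Longrightarrow> x \<in> cover L j \<Longrightarrow>
           s (i, x) = trans_fun L i j x * s (j, x)"
  shows "s \<in> sections L"
  using assms unfolding sections_def by blast

lemma sectionsD:
  assumes "s \<in> sections L"
  shows "\<not> (i \<in> indices L \<and> x \<in> cover L i) \<Longrightarrow> s (i, x) = 0"
    and "i \<in> indices L \<Longrightarrow> holo (cover L i) (\<lambda>x. s (i, x))"
    and "i \<in> indices L \<Longrightarrow> j \<in> indices L \<Longrightarrow> x \<in> cover L i \<Longrightarrow> x \<in> cover L j \<Longrightarrow>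
           s (i, x) = trans_fun L i j x * s (j, x)"
  using assms unfolding sections_def by blast+

lemma subspace_sections: "cfun.subspace (sections L)"
proof (rule cfun.subspaceI)
  show "0 \<in> sections L" by (rule sectionsI) (simp_all add: holo_const)
  show "s + t \<in> sections L" if s: "s \<in> sections L" and t: "t \<in> sections L" for s t
  proof (rule sectionsI)
    fix i j x
    assume "i \<in> indices L" "j \<in> indices L" "x \<in> cover L i" "x \<in> cover L j"
    from sectionsD(3)[OF s this] sectionsD(3)[OF t this]
    show "(s + t) (i, x) = trans_fun L i j x * (s + t) (j, x)"
      by (simp only: plus_fun_apply distrib_left)
  qed (use sectionsD(1,2)[OF s] sectionsD(1,2)[OF t] in \<open>simp_all add: holo_add\<close>)
  show "cscale a s \<in> sections L" if s: "s \<in> sections L" for a s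
  proof (rule sectionsI)
    fix i j x
    assume "i \<in> indices L" "j \<in> indices L" "x \<in> cover L i" "x \<in> cover L j"
    from sectionsD(3)[OF s this]
    show "cscale a s (i, x) = trans_fun L i j x * cscale a s (j, x)"
      by (simp only: cscale_def mult.left_commute)
  qed (use sectionsD(1,2)[OF s] in \<open>simp_all add: cscale_def holo_mult holo_const\<close>)
qed

lemma sections_mult:
  assumes s: "s \<in> sections (tensor_power L k)" and t: "t \<in> sections (tensor_power L m)"
  shows "s * t \<in> sections (tensor_power L (k + m))"
proof (rule sectionsI)
  fix i j x
  assume "i \<in> indices (tensor_power L (k + m))" "j \<in> indices (tensor_power L (k + m))"
    "x \<in> cover (tensor_power L (k + m)) i" "x \<in> cover (tensor_power L (k + m)) j"
  then have "s (i, x) = trans_fun L i j x ^ k * s (j, x)"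
    "t (i, x) = trans_fun L i j x ^ m * t (j, x)"
    using sectionsD(3)[OF s, of i j x] sectionsD(3)[OF t, of i j x] by simp_all
  then show "(s * t) (i, x) = trans_fun (tensor_power L (k + m)) i j x * (s * t) (j, x)"
    by (simp only: times_fun_apply tensor_power_simps power_add mult_ac)
qed (use sectionsD(1,2)[OF s] sectionsD(1,2)[OF t] in \<open>simp_all add: holo_mult\<close>)

text \<open>
  All powers of \<open>L\<close> share the cover of \<open>L\<close>, so that the three actions choose the same
  trivialization at the point \<open>h\<^sup>-\<^sup>1 \<cdot> x\<close> and the factors can be compared there.
\<close>

lemma section_action_mult:
  "section_action G act (tensor_power L (k + m)) h (s * t) =
     section_action G act (tensor_power L k) h s * section_action G act (tensor_power L m) h t"
  by (auto simp: section_action_def fun_eq_iff Let_def power_add)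

lemma section_vanishes_at_point:
  assumes s: "s \<in> sections L" and i: "i \<in> indices L" "x \<in> cover L i" and "s (i, x) = 0"
  shows "s (j, x) = 0"
proof (cases "j \<in> indices L \<and> x \<in> cover L j")
  case True
  then show ?thesis using sectionsD(3)[OF s, of j i x] i \<open>s (i, x) = 0\<close> by simp
qed (rule sectionsD(1)[OF s])

lemma zero_set_analytic:
  assumes "line_bundle M L" and s: "s \<in> sections L"
  shows "analytic_subset M {x \<in> M. \<forall>i. s (i, x) = 0}"
  unfolding analytic_subset_def
proof (intro conjI ballI)
  fix x assume "x \<in> M"
  then obtain i where i: "i \<in> indices L" "x \<in> cover L i"
    using assms(1) unfolding line_bundle_def by blast
  have "openin (top_on M) (cover L i)" "cover L i \<subseteq> M"
    using assms(1) i(1) unfolding line_bundle_def by blast+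
  then show "\<exists>U F. openin (top_on M) U \<and> x \<in> U \<and> finite F \<and> (\<forall>f\<in>F. holo U f) \<and>
      {x \<in> M. \<forall>i. s (i, x) = 0} \<inter> U = {y \<in> U. \<forall>f\<in>F. f y = 0}"
    using i sectionsD(2)[OF s i(1)] section_vanishes_at_point[OF s i(1)]
    by (intro exI[of _ "cover L i"] exI[of _ "{\<lambda>x. s (i, x)}"]) auto
qed auto

lemma line_bundle_tensor_power:
  assumes "line_bundle M L"
  shows "line_bundle M (tensor_power L k)"
proof -
  have "holo U (\<lambda>x. f x ^ k)" if "holo U f" for U :: "'a ppoint set" and f
    by (induction k) (auto intro!: holo_const holo_mult that)
  moreover have "trans_fun (tensor_power L k) i j = (\<lambda>x. trans_fun L i j x ^ k)" for i j
    by (simp add: fun_eq_iff)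
  ultimately show ?thesis
    using assms unfolding line_bundle_def by (simp flip: power_mult_distrib)
qed

text \<open>
  Wherever the product of two sections vanishes one of the factors does, so that their zero sets
  cover \<open>M\<close>; by irreducibility one of them is all of \<open>M\<close>.
\<close>

lemma section_mult_eq_0:
  fixes M :: "'m::finite ppoint set" and L :: "('g, 'i, 'm) lin_bundle"
  assumes "projective_variety M" and L: "line_bundle M L"
    and s: "s \<in> sections (tensor_power L k)" and t: "t \<in> sections (tensor_power L m)"
    and "s * t = 0"
  shows "s = 0 \<or> t = 0"
proof -
  define Z where "Z r = {x \<in> M. \<forall>i. r (i, x) = 0}" for r :: "'i \<times> 'm ppoint \<Rightarrow> complex"
  have zero: "r = 0" if "Z r = M" and r: "r \<in> sections (tensor_power L q)" for r q
  proof -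
    have "r (i, x) = 0" for i x
    proof (cases "i \<in> indices L \<and> x \<in> cover L i")
      case True
      then have "x \<in> M" using L unfolding line_bundle_def by blast
      then show ?thesis using \<open>Z r = M\<close> unfolding Z_def by blast
    next
      case False
      then show ?thesis using sectionsD(1)[OF r] by simp
    qed
    then show ?thesis by (auto simp: fun_eq_iff)
  qed
  have "x \<in> Z s \<union> Z t" if "x \<in> M" for x
  proof -
    obtain i where i: "i \<in> indices L" "x \<in> cover L i"
      using L \<open>x \<in> M\<close> unfolding line_bundle_def by blast
    have "s (i, x) * t (i, x) = 0"
      using fun_cong[OF \<open>s * t = 0\<close>, of "(i, x)"] by simp
    then consider "s (i, x) = 0" | "t (i, x) = 0" by auto
    then show ?thesis
    proof cases
      case 1
      then have "s (j, x) = 0" for j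
        using section_vanishes_at_point[OF s, of i x j] i by simp
      then show ?thesis using \<open>x \<in> M\<close> unfolding Z_def by blast
    next
      case 2
      then have "t (j, x) = 0" for j
        using section_vanishes_at_point[OF t, of i x j] i by simp
      then show ?thesis using \<open>x \<in> M\<close> unfolding Z_def by blast
    qed
  qed
  then have "Z s \<union> Z t = M" unfolding Z_def by blast
  moreover have "analytic_subset M (Z s)" "analytic_subset M (Z t)"
    unfolding Z_def using zero_set_analytic line_bundle_tensor_power L s t by blast+
  ultimately have "Z s = M \<or> Z t = M"
    using \<open>projective_variety M\<close> unfolding projective_variety_def by blast
  then show ?thesis using zero s t by blast
qed

section \<open>Multiplication by invariant sections\<close>

lemma nonzero_invariant_section:
  assumes "invariant_sections G act L \<noteq> {0}"
  obtains s where "s \<in> invariant_sections G act L" and "s \<noteq> 0"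
proof -
  have "0 \<in> invariant_sections G act L"
    using cfun.subspace_0[OF subspace_sections]
    by (auto simp: invariant_sections_def section_action_def fun_eq_iff Let_def)
  then show ?thesis using assms that by blast
qed

lemma invariant_exponents_add:
  assumes "projective_variety M" and "line_bundle M L"
    and "invariant_sections G act (tensor_power L k) \<noteq> {0}"
    and "invariant_sections G act (tensor_power L m) \<noteq> {0}"
  shows "invariant_sections G act (tensor_power L (k + m)) \<noteq> {0}"
proof -
  obtain s where s: "s \<in> invariant_sections G act (tensor_power L k)" "s \<noteq> 0"
    using nonzero_invariant_section[OF assms(3)] .
  obtain t where t: "t \<in> invariant_sections G act (tensor_power L m)" "t \<noteq> 0"
    using nonzero_invariant_section[OF assms(4)] .
  have "s * t \<in> invariant_sections G act (tensor_power L (k + m))"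
    using s(1) t(1) by (auto simp: invariant_sections_def sections_mult section_action_mult)
  moreover have "s * t \<noteq> 0"
    using section_mult_eq_0[OF assms(1,2), of s k t m] s t by (auto simp: invariant_sections_def)
  ultimately show ?thesis by blast
qed

text \<open>
  Multiplication by a nonzero invariant section \<open>s\<close> is equivariant because
  \<open>h \<cdot> (t * s) = (h \<cdot> t) * (h \<cdot> s) = (h \<cdot> t) * s\<close>, and injective because \<open>M\<close> is irreducible.
\<close>

lemma isotypic_dimension_mono:
  assumes "projective_variety M" and "line_bundle M L"
    and "invariant_sections G act (tensor_power L m) \<noteq> {0}"
  shows "edim (isotypic_component G V \<rho> (sections (tensor_power L k))
             (section_action G act (tensor_power L k))) \<le>
         edim (isotypic_component G V \<rho> (sections (tensor_power L (k + m)))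
             (section_action G act (tensor_power L (k + m))))"
proof -
  obtain s where s: "s \<in> invariant_sections G act (tensor_power L m)" "s \<noteq> 0"
    using nonzero_invariant_section[OF assms(3)] .
  then have s_sec: "s \<in> sections (tensor_power L m)"
    by (simp add: invariant_sections_def)
  let ?\<Phi> = "\<lambda>t. t * s"
  show ?thesis
  proof (rule edim_isotypic_component_le[where \<Phi> = ?\<Phi>])
    show "Vector_Spaces.linear cscale cscale ?\<Phi>"
      unfolding Vector_Spaces.linear_iff
      by (auto simp: cfun.vector_space_axioms cscale_def fun_eq_iff algebra_simps)
    show "cfun.subspace (sections (tensor_power L k))" by (rule subspace_sections)
    show "inj_on ?\<Phi> (sections (tensor_power L k))"
    proof (rule inj_onI)
      fix t t' assume t: "t \<in> sections (tensor_power L k)" "t' \<in> sections (tensor_power L k)"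
        and "t * s = t' * s"
      then have "(t - t') * s = 0" by (simp add: fun_eq_iff algebra_simps)
      moreover have "t - t' \<in> sections (tensor_power L k)"
        using cfun.subspace_diff[OF subspace_sections] t by blast
      ultimately have "t - t' = 0"
        using section_mult_eq_0[OF assms(1,2) _ s_sec] s(2) by blast
      then show "t = t'" by simp
    qed
    show "?\<Phi> ` sections (tensor_power L k) \<subseteq> sections (tensor_power L (k + m))"
      using sections_mult s_sec by blast
    show "section_action G act (tensor_power L k) h t * s =
        section_action G act (tensor_power L (k + m)) h (t * s)" if "h \<in> carrier G" for h t
      using s(1) that by (simp add: section_action_mult invariant_sections_def)
  qed
qed

theorem proposition5p1:
  fixes G :: "'g lie_group"
    and T :: "'g set" and C :: "(real \<Rightarrow> 'g) set" and \<mu> :: "'g \<Rightarrow> complex"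
    and M :: "'m::finite ppoint set"
    and act :: "'g \<Rightarrow> 'm ppoint \<Rightarrow> 'm ppoint"
    and L :: "('g, 'i, 'm) lin_bundle"
    and V :: "('c \<Rightarrow> complex) set"
    and \<rho> :: "'g \<Rightarrow> ('c \<Rightarrow> complex) \<Rightarrow> 'c \<Rightarrow> complex"
    and g n p :: nat
  assumes "is_lie_group g G" and "compact_space (gtop G)" and "connected_space (gtop G)"
    and "maximal_torus G T" and "weyl_chamber g G T C"
    and "projective_variety M" and "variety_dim M = enat n" and "holomorphic_action G M act"
    and "g \<le> n"
    and "linearized_line_bundle G M act L"
    and "\<exists>m\<ge>1. invariant_sections G act (tensor_power L m) \<noteq> {0}"
    and "p \<ge> 1" and "coprime p (G_exponent G act L)"
    and "irreducible_representation G V \<rho>" and "highest_weight g G T C V \<rho> \<mu>"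
  shows "vol_isotypic n g G act V \<rho> (tensor_power L p) =
           of_nat p ^ (n - g) * vol_isotypic n g G act V \<rho> L"
proof -
  have M: "projective_variety M" and L: "line_bundle M L"
    using assms(6,10) by (auto simp: linearized_line_bundle_def)
  define f where "f k = edim (isotypic_component G V \<rho> (sections (tensor_power L k))
    (section_action G act (tensor_power L k)))" for k
  define S where "S = {m. invariant_sections G act (tensor_power L m) \<noteq> {0}}"
  have "\<exists>m\<in>S. p dvd r + m" for r
  proof (rule additive_semigroup_meets_residues)
    show "a + b \<in> S" if "a \<in> S" "b \<in> S" for a b
      using that invariant_exponents_add[OF M L] unfolding S_def by blast
    show "S \<noteq> {}" using assms(11) unfolding S_def by blast
    show "coprime p (Gcd S)" using assms(13) unfolding S_def G_exponent_def .
  qed (fact assms(12))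
  then obtain m where m: "\<And>r. m r \<in> S" "\<And>r. p dvd r + m r" by metis
  \<comment> \<open>The shift \<open>m r\<close> depends only on the residue of the exponent, hence is bounded.\<close>
  define N where "N = Max (m ` {..<p})"
  have "\<exists>m\<le>N. p dvd k + m \<and> f k \<le> f (k + m)" for k
  proof (intro exI[of _ "m (k mod p)"] conjI)
    show "m (k mod p) \<le> N"
      unfolding N_def using assms(12) by (intro Max_ge) auto
    show "p dvd k + m (k mod p)"
      using m(2)[of "k mod p"] by (simp add: dvd_eq_mod_eq_0 mod_add_left_eq)
    show "f k \<le> f (k + m (k mod p))"
      using m(1)[of "k mod p"] isotypic_dimension_mono[OF M L] unfolding f_def S_def by blast
  qed
  then have "limsup (\<lambda>k. ennreal (fact (n - g) / real k ^ (n - g)) * f (p * k)) =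
      of_nat p ^ (n - g) * limsup (\<lambda>k. ennreal (fact (n - g) / real k ^ (n - g)) * f k)"
    by (rule limsup_along_multiples) (use assms(12) in auto)
  then show ?thesis
    unfolding vol_isotypic_def tensor_power_tensor_power f_def .
qed

end
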